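(* Consider the first-order Lax–Friedrichs type scheme $$\overline{\mathbf U}_j^{n+1}=\overline{\mathbf U}_j^n-\frac{\Delta t_n}{\Delta x}\Big(\hat{\mathbf F}_1(\overline{\mathbf U}_j^n,\overline{\mathbf U}_{j+1}^n)-\hat{\mathbf F}_1(\overline{\mathbf U}_{j-1}^n,\overline{\mathbf U}_j^n)\Big),\qquad \hat{\mathbf F}_1(\mathbf U^-,\mathbf U^+)=\frac12\Big(\mathbf F_1(\mathbf U^-)+\mathbf F_1(\mathbf U^+)-(\mathbf U^+-\mathbf U^-)\Big).$$ If $\overline{\mathbf U}_j^0\in\mathcal G$ and $\overline B_{1,j}^0=B_{\rm const}$ for all $j$ (with $B_{\rm const}$ independent of $j$), then $\overline{\mathbf U}_j^n$, computed by this scheme under the CFL type condition $$0<\Delta t_n\le\Delta x/c,\qquad c=1,$$ belongs to $\mathcal G$ and satisfies $\overline B_{1,j}^n=B_{\rm const}$ for all $j$ and all $n\in\mathbb N$.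
   Context: Fix the adiabatic index $\Gamma\in(1,2]$ (equation of state $p=(\Gamma-1)\rho e$; speed of light $c=1$). For primitive variables $\mathbf V=(\rho,\mathbf v,\mathbf B,p)$ with $\rho,p>0$, $\mathbf v,\mathbf B\in\mathbb R^3$, $|\mathbf v|<1$, put $W=(1-|\mathbf v|^2)^{-1/2}$, $e=\frac{p}{(\Gamma-1)\rho}$, $h=1+e+\frac p\rho$, $p_m=\frac12\big(W^{-2}|\mathbf B|^2+(\mathbf v\cdot\mathbf B)^2\big)$, $p_{tot}=p+p_m$. The associated conservative vector is $\mathbf U(\mathbf V)=(D,\mathbf m,\mathbf B,E)^\top\in\mathbb R^8$ with $D=\rho W$, $\mathbf m=\rho hW^2\mathbf v+|\mathbf B|^2\mathbf v-(\mathbf v\cdot\mathbf B)\mathbf B$, $E=\rho hW^2-p_{tot}+|\mathbf B|^2$. The admissible state set is $\mathcal G=\{\mathbf U(\mathbf V): \rho>0,\ p>0,\ |\mathbf v|<1,\ \mathbf B\in\mathbb R^3\}$. Each $\mathbf U\in\mathcal G$ determines its primitive variables, and for $\mathbf U\in\mathcal G$ the flux is $$\mathbf F_1(\mathbf U)=\Big(Dv_1,\ v_1\mathbf m-B_1\big(W^{-2}\mathbf B+(\mathbf v\cdot\mathbf B)\mathbf v\big)+p_{tot}\mathbf e_1,\ v_1\mathbf B-B_1\mathbf v,\ m_1\Big)^\top,\qquad\mathbf e_1=(1,0,0).$$ The mesh is uniform with step size $\Delta x>0$ and cells indexed by $j\in\mathbb Z$; $\Delta t_n$ is the time step at level $n$;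 $\overline{\mathbf U}_j^n\in\mathbb R^8$ is the approximate cell average and $\overline B_{1,j}^n$ its fifth component (the $B_1$ component). *)

theory Defs
  imports "HOL-Analysis.Analysis"
begin

text \<open>
  Relativistic magnetohydrodynamics with the ideal equation of state and the speed of light
  normalised to 1. The adiabatic index is passed explicitly as \<open>\<Gamma>\<close>.

  Primitive variables are tuples \<open>(\<rho>, v, B, p)\<close>. The space \<open>\<real>\<^sup>8\<close> of conservative vectors
  \<open>(D, m, B, E)\<close> is rendered blockwise as \<open>\<real> \<times> \<real>\<^sup>3 \<times> \<real>\<^sup>3 \<times> \<real>\<close>, with its componentwise
  vector space structure; its fifth scalar component is \<open>B $ 1\<close>.
\<close>

type_synonym vec3 = "real ^ 3"
type_synonym prim = "real \<times> vec3 \<times> vec3 \<times> real"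
type_synonym cons = "real \<times> vec3 \<times> vec3 \<times> real"

definition speed_of_light :: real where
  "speed_of_light = 1"

definition lorentz :: "vec3 \<Rightarrow> real" where
  "lorentz v = 1 / sqrt (1 - (norm v)\<^sup>2)"

definition internal_energy :: "real \<Rightarrow> real \<Rightarrow> real \<Rightarrow> real" where
  "internal_energy \<Gamma> \<rho> p = p / ((\<Gamma> - 1) * \<rho>)"

definition enthalpy :: "real \<Rightarrow> real \<Rightarrow> real \<Rightarrow> real" where
  "enthalpy \<Gamma> \<rho> p = 1 + internal_energy \<Gamma> \<rho> p + p / \<rho>"

definition mag_pressure :: "vec3 \<Rightarrow> vec3 \<Rightarrow> real" where
  "mag_pressure v B = ((norm B)\<^sup>2 / (lorentz v)\<^sup>2 + (v \<bullet> B)\<^sup>2) / 2"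

definition total_pressure :: "vec3 \<Rightarrow> vec3 \<Rightarrow> real \<Rightarrow> real" where
  "total_pressure v B p = p + mag_pressure v B"

definition mass_density :: "prim \<Rightarrow> real" where
  "mass_density = (\<lambda>(\<rho>, v, B, p). \<rho> * lorentz v)"

definition momentum :: "real \<Rightarrow> prim \<Rightarrow> vec3" where
  "momentum \<Gamma> = (\<lambda>(\<rho>, v, B, p).
     (\<rho> * enthalpy \<Gamma> \<rho> p * (lorentz v)\<^sup>2) *\<^sub>R v + (norm B)\<^sup>2 *\<^sub>R v - (v \<bullet> B) *\<^sub>R B)"

definition energy :: "real \<Rightarrow> prim \<Rightarrow> real" where
  "energy \<Gamma> = (\<lambda>(\<rho>, v, B, p).
     \<rho> * enthalpy \<Gamma> \<rho> p * (lorentz v)\<^sup>2 - total_pressure v B p + (norm B)\<^sup>2)"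

definition to_cons :: "real \<Rightarrow> prim \<Rightarrow> cons" where
  "to_cons \<Gamma> = (\<lambda>(\<rho>, v, B, p).
     (mass_density (\<rho>, v, B, p), momentum \<Gamma> (\<rho>, v, B, p), B, energy \<Gamma> (\<rho>, v, B, p)))"

definition admissible_prims :: "prim set" where
  "admissible_prims = {(\<rho>, v, B, p). \<rho> > 0 \<and> p > 0 \<and> norm v < 1}"

definition admissible :: "real \<Rightarrow> cons set" where
  "admissible \<Gamma> = to_cons \<Gamma> ` admissible_prims"

text \<open>
  On \<open>admissible \<Gamma>\<close> this recovers the primitive variables, which for \<open>1 < \<Gamma> \<le> 2\<close> are
  determined by the conservative vector; elsewhere the value is an arbitrary default, and
  \<open>flux1\<close> carries no meaning there.
\<close>

definition to_prim :: "real \<Rightarrow> cons \<Rightarrow> prim" where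
  "to_prim \<Gamma> = inv_into admissible_prims (to_cons \<Gamma>)"

definition prim_flux1 :: "real \<Rightarrow> prim \<Rightarrow> cons" where
  "prim_flux1 \<Gamma> = (\<lambda>(\<rho>, v, B, p).
     (mass_density (\<rho>, v, B, p) * v $ 1,
      v $ 1 *\<^sub>R momentum \<Gamma> (\<rho>, v, B, p)
        - B $ 1 *\<^sub>R ((1 / (lorentz v)\<^sup>2) *\<^sub>R B + (v \<bullet> B) *\<^sub>R v)
        + total_pressure v B p *\<^sub>R axis 1 1,
      v $ 1 *\<^sub>R B - B $ 1 *\<^sub>R v,
      momentum \<Gamma> (\<rho>, v, B, p) $ 1))"

definition flux1 :: "real \<Rightarrow> cons \<Rightarrow> cons" where
  "flux1 \<Gamma> U = prim_flux1 \<Gamma> (to_prim \<Gamma> U)"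

definition lf_flux1 :: "real \<Rightarrow> cons \<Rightarrow> cons \<Rightarrow> cons" where
  "lf_flux1 \<Gamma> Um Up = (1 / 2) *\<^sub>R (flux1 \<Gamma> Um + flux1 \<Gamma> Up - (Up - Um))"

definition B1_component :: "cons \<Rightarrow> real" where
  "B1_component = (\<lambda>(D, m, B, E). B $ 1)"

end

theory Submission
  imports Defs
begin

text \<open>
  The scheme writes the new cell average as a convex combination of the old one and of the mean
  of \<open>L + F L\<close> and \<open>R - F R\<close>, where \<open>L\<close> and \<open>R\<close> are the two neighbours and \<open>F\<close> is the flux. The
  normal magnetic component has zero flux, so it stays constant. The difficulty is that
  admissibility is a nonlinear condition on the conservative variables, and that \<open>L + F L\<close> alone
  need not be admissible.

  The first idea is to describe admissibility by linear inequalities. A state of positive mass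
  density is admissible if and only if, for every velocity \<open>w\<close> with \<open>|w| < 1\<close> and every field \<open>C\<close>,
  the linear functional \<open>observer_energy w C\<close> exceeds \<open>- mag_pressure w C\<close> on it. That this suffices is
  \<open>recover_primitive\<close>: the primitive variables are found by applying the intermediate value theorem
  to one scalar unknown, starting from the state of zero pressure, where the inequality with a suitable
  \<open>w\<close> says that the available energy is large enough.

  The second idea is the splitting inequality \<open>flux_splitting\<close>, which bounds the functional from below on
  \<open>X + \<theta> F X\<close> for \<open>\<theta> = 1\<close> and \<open>\<theta> = -1\<close>. Such a combination is a contraction of the stress-energy
  tensor with a null covector \<open>(1, n)\<close>, and the functional contracts with the velocity of the
  observer. The fluid part is strictly positive because the pressure is at most the internal energy
  density, which is where \<open>\<Gamma> \<le> 2\<close> enters. The magnetic part, together with the terms in \<open>C\<close>, is exactly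
  the contraction of the Maxwell tensor of a difference of two fields (\<open>ideal_field_em_flux\<close>), hence
  nonnegative by the dominant energy condition (\<open>em_flux_nonneg\<close>). The bound contains terms
  odd in \<open>\<theta>\<close>, one of them proportional to the normal magnetic component; they cancel between the two
  neighbours, which share that component.
\<close>

section \<open>Determinant identities in three dimensions\<close>

text \<open>
  This is \<open>det X * det (transpose Y) = det (X * transpose Y)\<close> for the matrices with rows
  \<open>a, b, c\<close> and \<open>x, y, z\<close>. It removes every cross product from the quadratic expressions below.
\<close>

lemma triple_product_mult:
  fixes a b c x y z :: "real^3"
  shows "(a \<bullet> cross3 b c) * (x \<bullet> cross3 y z) =
      (a \<bullet> x) * ((b \<bullet> y) * (c \<bullet> z) - (b \<bullet> z) * (c \<bullet> y))
    - (a \<bullet> y) * ((b \<bullet> x) * (c \<bullet> z) - (b \<bullet> z) * (c \<bullet> x))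
    + (a \<bullet> z) * ((b \<bullet> x) * (c \<bullet> y) - (b \<bullet> y) * (c \<bullet> x))"
proof -
  define X Y :: "real^3^3" where "X = vector [a, b, c]" and "Y = vector [x, y, z]"
  have entry: "(X ** transpose Y) $ i $ j = X $ i \<bullet> Y $ j" for i j
    by (simp add: matrix_matrix_mult_def transpose_def inner_vec_def)
  have "(a \<bullet> cross3 b c) * (x \<bullet> cross3 y z) = det (X ** transpose Y)"
    unfolding X_def Y_def by (simp add: dot_cross_det det_mul)
  also have "\<dots> = (a \<bullet> x) * ((b \<bullet> y) * (c \<bullet> z) - (b \<bullet> z) * (c \<bullet> y))
    - (a \<bullet> y) * ((b \<bullet> x) * (c \<bullet> z) - (b \<bullet> z) * (c \<bullet> x))
    + (a \<bullet> z) * ((b \<bullet> x) * (c \<bullet> y) - (b \<bullet> y) * (c \<bullet> x))"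
    unfolding det_3 entry by (simp add: X_def Y_def algebra_simps)
  finally show ?thesis .
qed

lemma cross3_cross3_left:
  fixes x y z :: "real^3"
  shows "cross3 (cross3 x y) z = (x \<bullet> z) *\<^sub>R y - (y \<bullet> z) *\<^sub>R x"
  using cross_skew[of "cross3 x y" z] by (simp add: Lagrange inner_commute)

section \<open>The electromagnetic dominant energy condition\<close>

text \<open>
  Let \<open>T\<close> be the Maxwell stress-energy tensor of the field \<open>(E, B)\<close>, with energy density
  \<open>u = (|E|\<^sup>2 + |B|\<^sup>2) / 2\<close>, Poynting vector \<open>S = E \<times> B\<close> and stress
  \<open>\<sigma> = u I - E \<otimes> E - B \<otimes> B\<close>. This is its contraction \<open>u + n \<bullet> S - w \<bullet> S - n \<bullet> \<sigma> w\<close>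
  with the covectors \<open>(1, n)\<close> and \<open>(1, - w)\<close>.
\<close>

definition em_flux :: "vec3 \<Rightarrow> vec3 \<Rightarrow> vec3 \<Rightarrow> vec3 \<Rightarrow> real" where
  "em_flux n w E B = (E \<bullet> E + B \<bullet> B) / 2 * (1 - n \<bullet> w) + (n - w) \<bullet> cross3 E B
     + (n \<bullet> E) * (w \<bullet> E) + (n \<bullet> B) * (w \<bullet> B)"

text \<open>
  The dominant energy condition. Contracting \<open>T\<close> with the null covector \<open>(1, n)\<close> leaves
  an energy \<open>u + n \<bullet> S\<close> and a momentum \<open>K\<close>, and the result is linear in \<open>w\<close>:
  \<open>u + n \<bullet> S - w \<bullet> K\<close>. For a null direction this four-momentum is itself null,
  \<open>|K| = u + n \<bullet> S\<close>; the identity behind that is that \<open>(n \<bullet> S)\<^sup>2\<close> is the Gram determinant of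
  \<open>n, E, B\<close>. The Cauchy-Schwarz inequality then finishes the proof.
\<close>

lemma em_flux_nonneg:
  assumes n: "norm n = 1" and w: "norm w \<le> 1"
  shows "em_flux n w E B \<ge> 0"
proof -
  define u where "u = (E \<bullet> E + B \<bullet> B) / 2"
  define S where "S = cross3 E B"
  define K where "K = S + u *\<^sub>R n - (n \<bullet> E) *\<^sub>R E - (n \<bullet> B) *\<^sub>R B"
  have nn: "n \<bullet> n = 1"
    using n by (simp add: norm_eq_1)
  have SE: "S \<bullet> E = 0" "S \<bullet> B = 0"
    unfolding S_def by (simp_all add: dot_cross_self)
  have SS: "S \<bullet> S = (E \<bullet> E) * (B \<bullet> B) - (E \<bullet> B)\<^sup>2"
    unfolding S_def by (simp add: dot_cross inner_commute power2_eq_square)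
  have nS: "(n \<bullet> S)\<^sup>2 = (E \<bullet> E) * (B \<bullet> B) - (E \<bullet> B)\<^sup>2
      - (B \<bullet> B) * (n \<bullet> E)\<^sup>2 - (E \<bullet> E) * (n \<bullet> B)\<^sup>2 + 2 * (n \<bullet> E) * (n \<bullet> B) * (E \<bullet> B)"
    unfolding S_def power2_eq_square triple_product_mult nn
    by (simp add: inner_commute algebra_simps)
  have "K \<bullet> K = S \<bullet> S + u\<^sup>2 + (n \<bullet> E)\<^sup>2 * (E \<bullet> E) + (n \<bullet> B)\<^sup>2 * (B \<bullet> B) + 2 * u * (n \<bullet> S)
      - 2 * u * (n \<bullet> E)\<^sup>2 - 2 * u * (n \<bullet> B)\<^sup>2 + 2 * (n \<bullet> E) * (n \<bullet> B) * (E \<bullet> B)"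
    using nn SE unfolding K_def
    by (simp add: inner_diff_left inner_diff_right inner_add_left inner_add_right
        inner_commute power2_eq_square algebra_simps)
  also have "\<dots> = (u + n \<bullet> S)\<^sup>2"
    unfolding SS power2_sum nS u_def by (simp add: field_simps power2_eq_square)
  finally have "K \<bullet> K = (u + n \<bullet> S)\<^sup>2" .
  then have K: "norm K = \<bar>u + n \<bullet> S\<bar>"
    by (simp add: norm_eq_sqrt_inner)
  have "\<bar>n \<bullet> S\<bar> \<le> norm S"
    using Cauchy_Schwarz_ineq2[of n S] n by simp
  also have "norm S \<le> norm E * norm B"
  proof (rule power2_le_imp_le)
    show "(norm S)\<^sup>2 \<le> (norm E * norm B)\<^sup>2"
      using norm_cross_dot[of E B] zero_le_power2[of "E \<bullet> B"] unfolding S_def by linarith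
  qed simp
  also have "\<dots> \<le> u"
    using sum_squares_bound[of "norm E" "norm B"] unfolding u_def
    by (simp add: power2_norm_eq_inner)
  finally have pos: "u + n \<bullet> S \<ge> 0" by linarith
  have "w \<bullet> K \<le> norm w * norm K"
    by (rule norm_cauchy_schwarz)
  also have "\<dots> \<le> 1 * norm K"
    using w by (intro mult_right_mono) auto
  finally have "w \<bullet> K \<le> u + n \<bullet> S" using K pos by simp
  moreover have "em_flux n w E B = u + n \<bullet> S - w \<bullet> K"
    unfolding em_flux_def K_def S_def[symmetric] u_def[symmetric]
    by (simp add: inner_diff_left inner_diff_right inner_add_right inner_commute algebra_simps)
  ultimately show ?thesis by simp
qed

section \<open>Energy seen by a reference observer\<close>

lemma norm_less_1_iff_inner: "norm v < 1 \<longleftrightarrow> v \<bullet> v < 1" for v :: vec3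
  by (simp add: norm_eq_sqrt_inner)

lemma inverse_lorentz: "1 / lorentz v = sqrt (1 - v \<bullet> v)"
  by (simp add: lorentz_def power2_norm_eq_inner)

lemma lorentz_pos: "norm v < 1 \<Longrightarrow> lorentz v > 0"
  by (simp add: lorentz_def power2_norm_eq_inner norm_less_1_iff_inner)

lemma inverse_lorentz_squared: "norm v < 1 \<Longrightarrow> 1 / (lorentz v)\<^sup>2 = 1 - v \<bullet> v"
  by (simp add: lorentz_def power2_norm_eq_inner power_divide norm_less_1_iff_inner)

text \<open>
  Up to a factor \<open>lorentz v\<close>, the spatial part of the four-vector of the magnetic field as
  measured in the rest frame of a fluid moving with velocity \<open>v\<close>.
\<close>

definition comoving_field :: "vec3 \<Rightarrow> vec3 \<Rightarrow> vec3" where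
  "comoving_field v B = (1 / (lorentz v)\<^sup>2) *\<^sub>R B + (v \<bullet> B) *\<^sub>R v"

text \<open>
  Up to a factor \<open>lorentz w\<close>, the energy that an observer with velocity \<open>w\<close> attributes to the state,
  per unit volume of the laboratory frame, less the rest mass, less the interaction with a magnetic
  field \<open>C\<close> prescribed by that observer. What matters is that it is linear in the state, for fixed \<open>w\<close> and
  \<open>C\<close>: a state of positive mass density is admissible if and only if
  \<open>observer_energy w C X + mag_pressure w C > 0\<close> for all \<open>|w| < 1\<close> and all \<open>C\<close>, and in this form
  admissibility is visibly a convex condition.
\<close>

definition observer_energy :: "vec3 \<Rightarrow> vec3 \<Rightarrow> cons \<Rightarrow> real" where
  "observer_energy w C = (\<lambda>(D, m, B, E). E - D / lorentz w - m \<bullet> w - B \<bullet> comoving_field w C)"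

lemma observer_energy_add:
  "observer_energy w C (X + Y) = observer_energy w C X + observer_energy w C Y"
  by (cases X; cases Y)
    (simp add: observer_energy_def inner_add_left add_divide_distrib)

lemma observer_energy_scaleR:
  "observer_energy w C (a *\<^sub>R X) = a * observer_energy w C X"
  by (cases X) (simp add: observer_energy_def algebra_simps)

lemma mag_pressure_inner:
  "norm v < 1 \<Longrightarrow> mag_pressure v B = ((1 - v \<bullet> v) * (B \<bullet> B) + (v \<bullet> B)\<^sup>2) / 2"
  by (simp add: mag_pressure_def power2_norm_eq_inner mult.commute flip: inverse_lorentz_squared)

lemma comoving_field_inner:
  "norm v < 1 \<Longrightarrow> comoving_field v B = (1 - v \<bullet> v) *\<^sub>R B + (v \<bullet> B) *\<^sub>R v"
  by (simp only: comoving_field_def inverse_lorentz_squared)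

section \<open>The splitting inequality\<close>

lemma one_plus_inner_pos:
  fixes n v :: "'a::real_inner"
  assumes "norm n = 1" "norm v < 1"
  shows "1 + n \<bullet> v > 0"
  using Cauchy_Schwarz_ineq2[of n v] assms by simp

text \<open>
  In physical terms, the relative Lorentz factor of two observers is at least 1.
\<close>

lemma sqrt_mult_sqrt_le_one_minus_inner:
  fixes v w :: "'a::real_inner"
  assumes "v \<bullet> v \<le> 1" "w \<bullet> w \<le> 1"
  shows "sqrt (1 - v \<bullet> v) * sqrt (1 - w \<bullet> w) \<le> 1 - v \<bullet> w"
proof -
  have "sqrt (1 - v \<bullet> v) * sqrt (1 - w \<bullet> w) \<le> ((1 - v \<bullet> v) + (1 - w \<bullet> w)) / 2"
    using assms arith_geo_mean_sqrt[of "1 - v \<bullet> v" "1 - w \<bullet> w"] by (simp add: real_sqrt_mult)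
  also have "\<dots> \<le> 1 - v \<bullet> w"
    using inner_ge_zero[of "v - w"]
    by (simp add: inner_diff_left inner_diff_right inner_commute field_simps)
  finally show ?thesis .
qed

text \<open>
  The difference of the two sides is \<open>|n + v|\<^sup>2 - w \<bullet> K\<close>, where \<open>|K| = |n + v|\<^sup>2\<close>: the linear
  function of \<open>w\<close> is again a contraction with a null vector. That vector is nonzero, as \<open>|v| < |n|\<close>.
\<close>

lemma pressure_flux_bound:
  fixes n v w :: "'a::real_inner"
  assumes n: "norm n = 1" and v: "norm v < 1" and w: "norm w < 1"
  shows "(1 - v \<bullet> v) * (1 + n \<bullet> w) < 2 * (1 + n \<bullet> v) * (1 - v \<bullet> w)"
proof -
  define K where "K = (2 * (1 + n \<bullet> v)) *\<^sub>R v + (1 - v \<bullet> v) *\<^sub>R n"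
  have nn: "n \<bullet> n = 1"
    using n by (simp add: norm_eq_1)
  have q: "(n + v) \<bullet> (n + v) = 2 * (1 + n \<bullet> v) - (1 - v \<bullet> v)"
    using nn by (simp add: inner_add_left inner_add_right inner_commute)
  have "K \<bullet> K = ((n + v) \<bullet> (n + v))\<^sup>2"
    unfolding K_def q using nn
    by (simp add: inner_add_left inner_add_right inner_commute power2_eq_square algebra_simps)
  then have K: "norm K = (n + v) \<bullet> (n + v)"
    by (simp add: norm_eq_sqrt_inner)
  have "n + v \<noteq> 0"
  proof
    assume "n + v = 0"
    then have "n = - v" by (simp add: eq_neg_iff_add_eq_0)
    with n v show False by simp
  qed
  then have "norm K > 0" using K by simp
  have "w \<bullet> K \<le> norm w * norm K"
    by (rule norm_cauchy_schwarz)
  also have "\<dots> < 1 * norm K"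
    using w \<open>norm K > 0\<close> by (intro mult_strict_right_mono) auto
  finally have "w \<bullet> K < 2 * (1 + n \<bullet> v) - (1 - v \<bullet> v)" using K q by simp
  then show ?thesis
    unfolding K_def by (simp add: inner_add_right inner_commute algebra_simps)
qed

text \<open>
  With \<open>H = \<rho> h\<close>, this is the non-magnetic part of the splitting inequality. The rest mass
  term is paid for by the share \<open>\<rho>\<close> of \<open>H\<close>, because the relative Lorentz factor of \<open>v\<close> and \<open>w\<close> is
  at least 1, and the pressure term by the share \<open>2 * p\<close>.
\<close>

lemma fluid_splitting:
  assumes n: "norm n = 1" and v: "norm v < 1" and w: "norm w < 1"
    and "\<rho> > 0" "p > 0" and H: "H \<ge> \<rho> + 2 * p"
  shows "H * (lorentz v)\<^sup>2 * (1 + n \<bullet> v) * (1 - v \<bullet> w) - p * (1 + n \<bullet> w)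
     - \<rho> * lorentz v * (1 + n \<bullet> v) / lorentz w > 0"
proof -
  define W where "W = lorentz v"
  define a where "a = 1 + n \<bullet> v"
  have W: "W > 0" using lorentz_pos[OF v] by (simp add: W_def)
  have a: "a > 0" using one_plus_inner_pos[OF n v] by (simp add: a_def)
  have vv: "v \<bullet> v < 1" and ww: "w \<bullet> w < 1"
    using v w by (simp_all add: norm_less_1_iff_inner)
  have g: "1 / lorentz w \<le> W * (1 - v \<bullet> w)"
  proof -
    have "1 / W * (1 / lorentz w) \<le> 1 - v \<bullet> w"
      unfolding W_def inverse_lorentz using vv ww by (intro sqrt_mult_sqrt_le_one_minus_inner) auto
    then have "W * (1 / W * (1 / lorentz w)) \<le> W * (1 - v \<bullet> w)"
      using W by (intro mult_left_mono) auto
    then show ?thesis using W by simp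
  qed
  have "1 / lorentz w > 0" using lorentz_pos[OF w] by simp
  with g W have vw: "1 - v \<bullet> w > 0"
    by (smt (verit) zero_less_mult_pos)
  have "1 / W\<^sup>2 * (1 + n \<bullet> w) < 2 * a * (1 - v \<bullet> w)"
    unfolding W_def a_def inverse_lorentz_squared[OF v] by (rule pressure_flux_bound[OF n v w])
  then have pr: "1 + n \<bullet> w < 2 * a * (1 - v \<bullet> w) * W\<^sup>2"
    using W by (simp add: field_simps)
  have "\<rho> * W * a * (1 / lorentz w) \<le> \<rho> * W * a * (W * (1 - v \<bullet> w))"
    using g W a \<open>\<rho> > 0\<close> by (intro mult_left_mono) auto
  moreover have "p * (1 + n \<bullet> w) < p * (2 * a * (1 - v \<bullet> w) * W\<^sup>2)"
    using pr \<open>p > 0\<close> by (intro mult_strict_left_mono) auto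
  moreover have "(\<rho> + 2 * p) * (W\<^sup>2 * a * (1 - v \<bullet> w)) \<le> H * (W\<^sup>2 * a * (1 - v \<bullet> w))"
    using H W a vw by (intro mult_right_mono) auto
  ultimately show ?thesis
    unfolding W_def[symmetric] a_def[symmetric]
    by (simp add: power2_eq_square algebra_simps)
qed

text \<open>
  The bound \<open>\<Gamma> \<le> 2\<close> says that the pressure does not exceed the internal energy density.
\<close>

lemma enthalpy_density_ge:
  assumes "1 < \<Gamma>" "\<Gamma> \<le> 2" "\<rho> > 0" "p > 0"
  shows "\<rho> * enthalpy \<Gamma> \<rho> p \<ge> \<rho> + 2 * p"
proof -
  have "\<rho> * enthalpy \<Gamma> \<rho> p = \<rho> + p / (\<Gamma> - 1) + p"
    using assms by (simp add: enthalpy_def internal_energy_def field_simps)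
  moreover have "p \<le> p / (\<Gamma> - 1)"
    using assms by (simp add: field_simps)
  ultimately show ?thesis by simp
qed

text \<open>
  In a perfectly conducting fluid the electric field is \<open>- (v \<times> B) = B \<times> v\<close>, and the magnetic
  pressure is the Lorentz invariant \<open>(|B|\<^sup>2 - |E|\<^sup>2) / 2\<close>. Contract the Maxwell tensor of the
  difference between the field \<open>(B \<times> v, B)\<close> of the flow and the field \<open>(C \<times> w, C)\<close> of the
  reference flow. Its part quadratic in \<open>B\<close> is the magnetic energy and momentum of the state and
  of its flux, the part quadratic in \<open>C\<close> is \<open>(1 + n \<bullet> w) * mag_pressure w C\<close> since the
  reference field is purely magnetic in its own rest frame, and the mixed part is the
  pairing of \<open>B\<close> and of its flux with the comoving field of the reference flow, up to the single
  term \<open>(n \<bullet> B) * (w \<bullet> C)\<close>. So the magnetic part of the splitting inequality is one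
  electromagnetic energy.
\<close>

lemma ideal_field_em_flux:
  fixes v B w C n :: vec3
  defines "S \<equiv> (B \<bullet> B) *\<^sub>R v - (v \<bullet> B) *\<^sub>R B"
  assumes v: "norm v < 1" and w: "norm w < 1"
  shows "em_flux n w (cross3 B v - cross3 C w) (B - C) =
     (B \<bullet> B - mag_pressure v B - w \<bullet> S - B \<bullet> comoving_field w C)
     + (n \<bullet> S - w \<bullet> ((n \<bullet> v) *\<^sub>R S - (n \<bullet> B) *\<^sub>R comoving_field v B + mag_pressure v B *\<^sub>R n)
        - ((n \<bullet> v) *\<^sub>R B - (n \<bullet> B) *\<^sub>R v) \<bullet> comoving_field w C)
     + (1 + n \<bullet> w) * mag_pressure w C - (n \<bullet> B) * (w \<bullet> C)"
proof -
  have 1: "cross3 (cross3 B v - cross3 C w) (B - C) =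
     (B \<bullet> (B - C)) *\<^sub>R v - (v \<bullet> (B - C)) *\<^sub>R B - (C \<bullet> (B - C)) *\<^sub>R w + (w \<bullet> (B - C)) *\<^sub>R C"
    by (simp add: Cross3.left_diff_distrib cross3_cross3_left)
  have 2: "(n \<bullet> (cross3 B v - cross3 C w)) * (w \<bullet> (cross3 B v - cross3 C w)) =
     (n \<bullet> cross3 B v) * (w \<bullet> cross3 B v) - (n \<bullet> cross3 C w) * (w \<bullet> cross3 B v)"
    by (simp add: inner_diff_right dot_cross_self algebra_simps)
  have 3: "(cross3 B v - cross3 C w) \<bullet> (cross3 B v - cross3 C w) =
     (B \<bullet> B) * (v \<bullet> v) - (v \<bullet> B)\<^sup>2 - 2 * ((B \<bullet> C) * (v \<bullet> w) - (B \<bullet> w) * (v \<bullet> C))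
     + (C \<bullet> C) * (w \<bullet> w) - (w \<bullet> C)\<^sup>2"
    by (simp add: inner_diff_right inner_diff_left dot_cross inner_commute power2_eq_square)
  show ?thesis
    unfolding em_flux_def 1 2 3 triple_product_mult S_def
      mag_pressure_inner[OF v] mag_pressure_inner[OF w] comoving_field_inner[OF v] comoving_field_inner[OF w]
    unfolding inner_diff_right inner_diff_left inner_add_left inner_add_right
      inner_scaleR_left inner_scaleR_right
    by (simp add: power2_eq_square inner_commute field_simps)
qed

text \<open>
  The generalised Lax-Friedrichs splitting property. With \<open>n = \<theta> *\<^sub>R axis 1 1\<close>, adding \<open>\<theta>\<close> times
  the flux contracts the stress-energy tensor with the null covector \<open>(1, n)\<close> instead of \<open>(1, 0)\<close>.
  The left-hand side is the sum of the fluid part and of the electromagnetic energy of the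
  difference field, and the former is strictly positive. Neither \<open>\<theta> * w $ 1\<close> nor the term with
  \<open>B $ 1\<close> has a sign, but both are odd in \<open>\<theta>\<close>.
\<close>

lemma flux_splitting:
  assumes "1 < \<Gamma>" "\<Gamma> \<le> 2" and V: "(\<rho>, v, B, p) \<in> admissible_prims"
    and w: "norm w < 1" and \<theta>: "\<bar>\<theta>\<bar> = 1"
  shows "observer_energy w C (to_cons \<Gamma> (\<rho>, v, B, p) + \<theta> *\<^sub>R prim_flux1 \<Gamma> (\<rho>, v, B, p))
     + (1 + \<theta> * w $ 1) * mag_pressure w C - \<theta> * B $ 1 * (w \<bullet> C) > 0"
proof -
  have pos: "\<rho> > 0" "p > 0" and v: "norm v < 1"
    using V by (auto simp: admissible_prims_def)
  define n :: vec3 where "n = \<theta> *\<^sub>R axis 1 1"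
  have n: "norm n = 1"
    using \<theta> by (simp add: n_def)
  have nx: "\<theta> * x $ 1 = n \<bullet> x" for x :: vec3
    by (simp add: n_def inner_axis')
  define G where "G = \<rho> * enthalpy \<Gamma> \<rho> p * (lorentz v)\<^sup>2"
  define S where "S = (B \<bullet> B) *\<^sub>R v - (v \<bullet> B) *\<^sub>R B"
  define P where "P = mag_pressure v B"
  define c where "c = comoving_field v B"
  have m: "momentum \<Gamma> (\<rho>, v, B, p) = G *\<^sub>R v + S"
    by (simp add: momentum_def G_def S_def power2_norm_eq_inner)
  have en: "energy \<Gamma> (\<rho>, v, B, p) = G - (p + P) + B \<bullet> B"
    by (simp add: energy_def G_def total_pressure_def P_def power2_norm_eq_inner)
  have F: "\<theta> *\<^sub>R prim_flux1 \<Gamma> (\<rho>, v, B, p) =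
     (\<rho> * lorentz v * (n \<bullet> v), (n \<bullet> v) *\<^sub>R (G *\<^sub>R v + S) - (n \<bullet> B) *\<^sub>R c + (p + P) *\<^sub>R n,
      (n \<bullet> v) *\<^sub>R B - (n \<bullet> B) *\<^sub>R v, n \<bullet> (G *\<^sub>R v + S))"
    unfolding prim_flux1_def m[unfolded prod.case] nx[symmetric]
    by (simp add: m mass_density_def total_pressure_def P_def c_def comoving_field_def n_def
        scaleR_add_right scaleR_diff_right mult_ac)
  have "0 < (G * (1 + n \<bullet> v) * (1 - v \<bullet> w) - p * (1 + n \<bullet> w)
        - \<rho> * lorentz v * (1 + n \<bullet> v) / lorentz w)
     + em_flux n w (cross3 B v - cross3 C w) (B - C)"
    unfolding G_def
    by (intro add_pos_nonneg fluid_splitting n v w pos enthalpy_density_ge assms(1,2)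
        em_flux_nonneg less_imp_le)
  also have "\<dots> = observer_energy w C (to_cons \<Gamma> (\<rho>, v, B, p) + \<theta> *\<^sub>R prim_flux1 \<Gamma> (\<rho>, v, B, p))
     + (1 + n \<bullet> w) * mag_pressure w C - (n \<bullet> B) * (w \<bullet> C)"
    unfolding ideal_field_em_flux[OF v w] S_def[symmetric] P_def[symmetric] c_def[symmetric] F
      to_cons_def prod.case m en mass_density_def
    by (simp add: observer_energy_def inner_add_left inner_add_right inner_diff_left inner_diff_right
        inner_commute algebra_simps add_divide_distrib)
  finally show ?thesis
    unfolding nx .
qed

section \<open>Recovering primitive variables\<close>

text \<open>
  For fixed \<open>w\<close>, the sum of \<open>observer_energy w C\<close> and \<open>mag_pressure w C\<close> is a convex quadratic
  function of \<open>C\<close>, smallest when \<open>C\<close> is the magnetic field \<open>B\<close> of the state. This is its minimum.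
\<close>

lemma observer_energy_own_field:
  assumes "norm w < 1"
  shows "observer_energy w B (D, m, B, E) + mag_pressure w B
    = E - D * sqrt (1 - w \<bullet> w) - m \<bullet> w - ((1 - w \<bullet> w) * (B \<bullet> B) + (w \<bullet> B)\<^sup>2) / 2"
proof -
  have "D / lorentz w = D * sqrt (1 - w \<bullet> w)"
    using inverse_lorentz[of w] by (simp add: divide_inverse)
  then show ?thesis
    unfolding mag_pressure_inner[OF assms] observer_energy_def comoving_field_inner[OF assms] prod.case
      inner_add_right inner_scaleR_right
    by (simp add: inner_commute power2_eq_square field_simps)
qed

text \<open>
  Primitive variables in terms of the single unknown \<open>\<xi> = \<rho> h W\<^sup>2\<close>: the mass equation gives
  \<open>\<rho> = D / W\<close>, the definition of \<open>\<xi>\<close> gives \<open>p\<close>, and the momentum and energy equations remain.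
\<close>

lemma to_cons_eqI:
  assumes "1 < \<Gamma>" and s: "s = sqrt (1 - v \<bullet> v)" "s > 0" and "D > 0"
    and p: "p = (\<Gamma> - 1) / \<Gamma> * (\<xi> * s\<^sup>2 - D * s)"
    and m: "m = (\<xi> + B \<bullet> B) *\<^sub>R v - (v \<bullet> B) *\<^sub>R B"
    and E: "E = \<xi> - p + B \<bullet> B - (s\<^sup>2 * (B \<bullet> B) + (v \<bullet> B)\<^sup>2) / 2"
  shows "to_cons \<Gamma> (D * s, v, B, p) = (D, m, B, E)"
proof -
  have W: "lorentz v = 1 / s"
    using s(1) by (simp add: lorentz_def power2_norm_eq_inner)
  have "D * s * enthalpy \<Gamma> (D * s) p = D * s + p * (\<Gamma> / (\<Gamma> - 1))"
    using assms(1) \<open>D > 0\<close> s(2) by (simp add: enthalpy_def internal_energy_def field_simps)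
  also have "\<dots> = \<xi> * s\<^sup>2"
    unfolding p using assms(1) by simp
  finally have h: "D * s * enthalpy \<Gamma> (D * s) p * (lorentz v)\<^sup>2 = \<xi>"
    unfolding W using s(2) by (simp add: power_divide)
  have P: "mag_pressure v B = (s\<^sup>2 * (B \<bullet> B) + (v \<bullet> B)\<^sup>2) / 2"
    unfolding mag_pressure_def W using s(2)
    by (simp add: power2_norm_eq_inner power_divide mult.commute)
  show ?thesis
    unfolding to_cons_def prod.case momentum_def energy_def mass_density_def h E m total_pressure_def P
    using s(2) W by (simp add: power2_norm_eq_inner scaleR_add_left)
qed

text \<open>
  For each \<open>\<xi> > 0\<close> the momentum equation is linear in the velocity and has an explicit solution
  \<open>v \<xi>\<close>, whose norm decreases with \<open>\<xi>\<close>. The velocity is subluminal and the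
  pressure positive exactly if \<open>k \<xi> = |v \<xi>|\<^sup>2 + D\<^sup>2 / \<xi>\<^sup>2 < 1\<close>, that is, for \<open>\<xi>\<close> above the point \<open>\<xi>\<^sub>0\<close> where
  \<open>k = 1\<close>. There the pressure vanishes, and the hypothesis for the observer \<open>w = v \<xi>\<^sub>0\<close> says precisely
  that the energy \<open>\<Phi> \<xi>\<^sub>0\<close> of that cold state is below \<open>E\<close>. As \<open>\<Phi>\<close> grows at least like \<open>\<xi> / \<Gamma>\<close>, it
  attains the value \<open>E\<close> somewhere above \<open>\<xi>\<^sub>0\<close>.
\<close>

lemma recover_primitive:
  assumes "1 < \<Gamma>" and "D > 0"
    and energy: "\<And>w. norm w < 1 \<Longrightarrow> observer_energy w B (D, m, B, E) + mag_pressure w B > 0"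
  shows "(D, m, B, E) \<in> admissible \<Gamma>"
proof -
  define \<beta> where "\<beta> = B \<bullet> B"
  define \<mu> where "\<mu> = m \<bullet> B"
  define v where "v \<xi> = (1 / (\<xi> + \<beta>)) *\<^sub>R (m + (\<mu> / \<xi>) *\<^sub>R B)" for \<xi>
  define k where "k \<xi> = v \<xi> \<bullet> v \<xi> + D\<^sup>2 / \<xi>\<^sup>2" for \<xi>
  define p where "p \<xi> = (\<Gamma> - 1) / \<Gamma> * (\<xi> * (1 - v \<xi> \<bullet> v \<xi>) - D * sqrt (1 - v \<xi> \<bullet> v \<xi>))" for \<xi>
  define P where "P \<xi> = ((1 - v \<xi> \<bullet> v \<xi>) * \<beta> + (v \<xi> \<bullet> B)\<^sup>2) / 2" for \<xi>
  define \<Phi> where "\<Phi> \<xi> = \<xi> - p \<xi> + \<beta> - P \<xi>" for \<xi>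
  have \<beta>: "\<beta> \<ge> 0" by (simp add: \<beta>_def)
  have vB: "v \<xi> \<bullet> B = \<mu> / \<xi>" if "\<xi> > 0" for \<xi>
  proof -
    have "v \<xi> \<bullet> B = (\<mu> + \<mu> / \<xi> * \<beta>) / (\<xi> + \<beta>)"
      by (simp add: v_def \<mu>_def \<beta>_def inner_add_left)
    also have "\<mu> + \<mu> / \<xi> * \<beta> = \<mu> / \<xi> * (\<xi> + \<beta>)"
      using that by (simp add: field_simps)
    finally show ?thesis using that \<beta> by simp
  qed
  have m: "m = (\<xi> + \<beta>) *\<^sub>R v \<xi> - (v \<xi> \<bullet> B) *\<^sub>R B" if "\<xi> > 0" for \<xi>
    unfolding vB[OF that] using that \<beta> by (simp add: v_def)
  have vv: "v \<xi> \<bullet> v \<xi> = (m \<bullet> m + 2 * \<mu>\<^sup>2 / \<xi> + \<mu>\<^sup>2 * \<beta> / \<xi>\<^sup>2) / (\<xi> + \<beta>)\<^sup>2" for \<xi>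
  proof -
    have "v \<xi> \<bullet> v \<xi> = ((m + (\<mu> / \<xi>) *\<^sub>R B) \<bullet> (m + (\<mu> / \<xi>) *\<^sub>R B)) / (\<xi> + \<beta>)\<^sup>2"
      by (simp add: v_def power2_eq_square)
    also have "(m + (\<mu> / \<xi>) *\<^sub>R B) \<bullet> (m + (\<mu> / \<xi>) *\<^sub>R B) = m \<bullet> m + 2 * \<mu>\<^sup>2 / \<xi> + \<mu>\<^sup>2 * \<beta> / \<xi>\<^sup>2"
      by (simp add: inner_add_left inner_add_right inner_commute \<mu>_def \<beta>_def power2_eq_square)
    finally show ?thesis .
  qed
  have k_less: "k \<eta> < k \<xi>" if "0 < \<xi>" "\<xi> < \<eta>" for \<xi> \<eta>
  proof -
    have "v \<eta> \<bullet> v \<eta> \<le> v \<xi> \<bullet> v \<xi>"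
      unfolding vv using that \<beta>
      by (intro frac_le add_mono divide_left_mono power_mono) auto
    moreover have "D\<^sup>2 / \<eta>\<^sup>2 < D\<^sup>2 / \<xi>\<^sup>2"
      using that \<open>D > 0\<close> by (intro divide_strict_left_mono power_strict_mono) auto
    ultimately show ?thesis by (simp add: k_def)
  qed
  have cont_v: "continuous_on {a..b} v" if "0 < a" for a b
    unfolding v_def using that \<beta> by (intro continuous_intros) auto

  obtain \<xi>\<^sub>0 where \<xi>\<^sub>0: "\<xi>\<^sub>0 \<ge> D" "k \<xi>\<^sub>0 = 1"
  proof -
    \<comment> \<open>For \<open>\<xi> \<ge> 1\<close> one has \<open>k \<xi> \<le> A / \<xi>\<^sup>2\<close>.\<close>
    define A where "A = m \<bullet> m + 2 * \<mu>\<^sup>2 + \<mu>\<^sup>2 * \<beta> + D\<^sup>2"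
    define X where "X = A + D + 1"
    have "A \<ge> 0" using \<beta> by (simp add: A_def)
    then have X: "X \<ge> 1" "X > A" "X \<ge> D" using \<open>D > 0\<close> by (auto simp: X_def)
    have "X \<le> X\<^sup>2" using X(1) by (simp add: power2_eq_square)
    then have "A / X\<^sup>2 < 1" using X by (simp add: field_simps)
    moreover have "v X \<bullet> v X \<le> (m \<bullet> m + 2 * \<mu>\<^sup>2 / 1 + \<mu>\<^sup>2 * \<beta> / 1\<^sup>2) / X\<^sup>2"
      unfolding vv using X \<beta>
      by (intro frac_le add_mono divide_left_mono power_mono) auto
    ultimately have "k X \<le> 1"
      by (simp add: k_def A_def add_divide_distrib)
    moreover have "1 \<le> k D" using \<open>D > 0\<close> by (simp add: k_def)
    moreover have "continuous_on {D..X} k"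
      unfolding k_def using \<open>D > 0\<close> by (intro continuous_intros cont_v) auto
    ultimately show thesis
      using IVT2'[of k X 1 D] X(3) that by blast
  qed
  have "\<xi>\<^sub>0 > 0" using \<xi>\<^sub>0(1) \<open>D > 0\<close> by simp
  have subluminal: "v \<xi> \<bullet> v \<xi> < 1" if "\<xi> \<ge> \<xi>\<^sub>0" for \<xi>
  proof -
    have "k \<xi> \<le> 1"
      using k_less[OF \<open>\<xi>\<^sub>0 > 0\<close>, of \<xi>] that \<xi>\<^sub>0(2) by (cases "\<xi> = \<xi>\<^sub>0") auto
    moreover have "D\<^sup>2 / \<xi>\<^sup>2 > 0" using that \<open>\<xi>\<^sub>0 > 0\<close> \<open>D > 0\<close> by simp
    ultimately show ?thesis unfolding k_def by linarith
  qed

  have "\<Phi> \<xi>\<^sub>0 < E"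
  proof -
    \<comment> \<open>At \<open>\<xi>\<^sub>0\<close> the Lorentz factor is \<open>\<xi>\<^sub>0 / D\<close>, as for pressureless matter.\<close>
    define a where "a = 1 - v \<xi>\<^sub>0 \<bullet> v \<xi>\<^sub>0"
    have a: "a = (D / \<xi>\<^sub>0)\<^sup>2"
      using \<xi>\<^sub>0(2) unfolding k_def a_def by (simp add: power_divide)
    then have sa: "sqrt a = D / \<xi>\<^sub>0"
      using \<open>D > 0\<close> \<open>\<xi>\<^sub>0 > 0\<close> by simp
    have xa: "\<xi>\<^sub>0 * a = D * (D / \<xi>\<^sub>0)"
      unfolding a using \<open>\<xi>\<^sub>0 > 0\<close> by (simp add: power2_eq_square)
    have "p \<xi>\<^sub>0 = 0"
      unfolding p_def a_def[symmetric] sa xa by simp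
    moreover have "m \<bullet> v \<xi>\<^sub>0 = (\<xi>\<^sub>0 + \<beta>) * (1 - a) - (v \<xi>\<^sub>0 \<bullet> B)\<^sup>2"
      using arg_cong[OF m[OF \<open>\<xi>\<^sub>0 > 0\<close>], of "\<lambda>x. x \<bullet> v \<xi>\<^sub>0"]
      unfolding inner_diff_left inner_scaleR_left
      by (simp add: a_def inner_commute power2_eq_square)
    moreover have "E - D * (D / \<xi>\<^sub>0) - m \<bullet> v \<xi>\<^sub>0 - P \<xi>\<^sub>0 > 0"
      using energy[of "v \<xi>\<^sub>0"] subluminal[of \<xi>\<^sub>0] observer_energy_own_field[of "v \<xi>\<^sub>0" B D m E]
      unfolding norm_less_1_iff_inner P_def \<beta>_def a_def[symmetric] sa by simp
    ultimately show ?thesis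
      unfolding \<Phi>_def P_def a_def[symmetric] using xa by (simp add: algebra_simps add_divide_distrib)
  qed
  moreover obtain Y where Y: "Y \<ge> \<xi>\<^sub>0" "\<Phi> Y \<ge> E"
  proof
    define Y where "Y = max \<xi>\<^sub>0 (\<Gamma> * E)"
    show "Y \<ge> \<xi>\<^sub>0" by (simp add: Y_def)
    have "Y > 0" using \<open>\<xi>\<^sub>0 > 0\<close> by (simp add: Y_def)
    note sub = subluminal[OF \<open>Y \<ge> \<xi>\<^sub>0\<close>]
    have "Y * (1 - v Y \<bullet> v Y) - D * sqrt (1 - v Y \<bullet> v Y) \<le> Y"
    proof -
      have "Y * (1 - v Y \<bullet> v Y) \<le> Y" using \<open>Y > 0\<close> by (simp add: mult_le_cancel_left1)
      moreover have "D * sqrt (1 - v Y \<bullet> v Y) \<ge> 0" using sub \<open>D > 0\<close> by simp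
      ultimately show ?thesis by linarith
    qed
    then have "p Y \<le> (\<Gamma> - 1) / \<Gamma> * Y"
      unfolding p_def using assms(1) by (intro mult_left_mono) auto
    also have "\<dots> = Y - Y / \<Gamma>" using assms(1) by (simp add: field_simps)
    finally have "p Y \<le> Y - Y / \<Gamma>" .
    moreover have "E \<le> Y / \<Gamma>" using assms(1) by (simp add: Y_def field_simps)
    moreover have "P Y \<le> \<beta>"
    proof -
      have "(v Y \<bullet> B)\<^sup>2 \<le> (v Y \<bullet> v Y) * \<beta>"
        unfolding \<beta>_def by (rule Cauchy_Schwarz_ineq)
      then show ?thesis using \<beta> unfolding P_def by (simp add: algebra_simps)
    qed
    ultimately show "\<Phi> Y \<ge> E" unfolding \<Phi>_def by linarith
  qed
  moreover have "continuous_on {\<xi>\<^sub>0..Y} \<Phi>"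
    unfolding \<Phi>_def p_def P_def using \<open>\<xi>\<^sub>0 > 0\<close> by (intro continuous_intros cont_v) auto
  ultimately obtain \<xi> where \<xi>: "\<xi>\<^sub>0 < \<xi>" "\<Phi> \<xi> = E"
    using IVT'[of \<Phi> \<xi>\<^sub>0 E Y] by (metis less_eq_real_def less_irrefl)
  have "\<xi> > 0" using \<xi>(1) \<open>\<xi>\<^sub>0 > 0\<close> by simp
  define s where "s = sqrt (1 - v \<xi> \<bullet> v \<xi>)"
  have "v \<xi> \<bullet> v \<xi> < 1" using \<xi>(1) by (intro subluminal) simp
  then have s: "s > 0" and s2: "1 - v \<xi> \<bullet> v \<xi> = s\<^sup>2" by (auto simp: s_def)
  have "D\<^sup>2 / \<xi>\<^sup>2 < s\<^sup>2"
    using k_less[OF \<open>\<xi>\<^sub>0 > 0\<close> \<xi>(1)] \<xi>\<^sub>0(2) s2 unfolding k_def by linarith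
  then have "D\<^sup>2 < (\<xi> * s)\<^sup>2"
    using \<open>\<xi> > 0\<close> by (simp add: field_simps power_mult_distrib)
  then have "D < \<xi> * s"
    by (rule power2_less_imp_less) (use s \<open>\<xi> > 0\<close> in simp)
  then have "s * (\<xi> * s - D) > 0" using s by simp
  then have "\<xi> * s\<^sup>2 - D * s > 0" by (simp add: power2_eq_square algebra_simps)
  moreover have p\<xi>: "p \<xi> = (\<Gamma> - 1) / \<Gamma> * (\<xi> * s\<^sup>2 - D * s)"
    unfolding p_def s_def[symmetric] unfolding s2 ..
  ultimately have "p \<xi> > 0"
    using assms(1) by simp
  moreover have "to_cons \<Gamma> (D * s, v \<xi>, B, p \<xi>) = (D, m, B, E)"
    by (rule to_cons_eqI[OF assms(1) s_def s \<open>D > 0\<close> p\<xi> m[OF \<open>\<xi> > 0\<close>, unfolded \<beta>_def]])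
      (use \<xi>(2) in \<open>simp add: \<Phi>_def P_def s2 \<beta>_def\<close>)
  ultimately show ?thesis
    using \<open>v \<xi> \<bullet> v \<xi> < 1\<close> s \<open>D > 0\<close> unfolding admissible_def admissible_prims_def
    by (intro image_eqI[where x = "(D * s, v \<xi>, B, p \<xi>)"]) (auto simp: norm_less_1_iff_inner)
qed

section \<open>One step of the scheme\<close>

lemma to_prim_admissible:
  assumes "X \<in> admissible \<Gamma>"
  shows "to_prim \<Gamma> X \<in> admissible_prims" "to_cons \<Gamma> (to_prim \<Gamma> X) = X"
  using assms unfolding admissible_def to_prim_def
  by (auto intro: inv_into_into f_inv_into_f)

lemma B1_component_linear [simp]:
  "B1_component (X + Y) = B1_component X + B1_component Y"
  "B1_component (X - Y) = B1_component X - B1_component Y"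
  "B1_component (a *\<^sub>R X) = a * B1_component X"
  by (cases X; cases Y; simp add: B1_component_def)+

lemma B1_component_flux1: "B1_component (flux1 \<Gamma> X) = 0"
  by (cases "to_prim \<Gamma> X") (simp add: flux1_def prim_flux1_def B1_component_def)

lemma flux1_splitting:
  assumes "1 < \<Gamma>" "\<Gamma> \<le> 2" and X: "X \<in> admissible \<Gamma>"
    and w: "norm w < 1" and \<theta>: "\<bar>\<theta>\<bar> = 1"
  shows "observer_energy w C (X + \<theta> *\<^sub>R flux1 \<Gamma> X)
     + (1 + \<theta> * w $ 1) * mag_pressure w C - \<theta> * B1_component X * (w \<bullet> C) > 0"
proof -
  obtain \<rho> v B p where V: "to_prim \<Gamma> X = (\<rho>, v, B, p)"
    by (cases "to_prim \<Gamma> X")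
  have adm: "(\<rho>, v, B, p) \<in> admissible_prims" and X': "to_cons \<Gamma> (\<rho>, v, B, p) = X"
    using to_prim_admissible[OF X] V by auto
  have "B1_component X = B $ 1"
    unfolding X'[symmetric] by (simp add: to_cons_def B1_component_def)
  then show ?thesis
    using flux_splitting[OF assms(1,2) adm w \<theta>, of C] unfolding flux1_def V X' by simp
qed

lemma mass_flux1_splitting:
  assumes X: "X \<in> admissible \<Gamma>" and \<theta>: "\<bar>\<theta>\<bar> = 1"
  shows "fst (X + \<theta> *\<^sub>R flux1 \<Gamma> X) > 0"
proof -
  obtain \<rho> v B p where V: "to_prim \<Gamma> X = (\<rho>, v, B, p)"
    by (cases "to_prim \<Gamma> X")
  have adm: "\<rho> > 0" "norm v < 1" and X': "to_cons \<Gamma> (\<rho>, v, B, p) = X"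
    using to_prim_admissible[OF X] V by (auto simp: admissible_prims_def)
  have "\<bar>\<theta> * v $ 1\<bar> < 1"
    using component_le_norm_cart[of v 1] adm(2) \<theta> by (simp add: abs_mult)
  then have "\<rho> * lorentz v * (1 + \<theta> * v $ 1) > 0"
    using adm(1) lorentz_pos[OF adm(2)] by simp
  moreover have "fst X = \<rho> * lorentz v"
    unfolding X'[symmetric] by (simp add: to_cons_def mass_density_def)
  moreover have "fst (flux1 \<Gamma> X) = \<rho> * lorentz v * v $ 1"
    unfolding flux1_def V by (simp add: prim_flux1_def mass_density_def)
  ultimately show ?thesis by (simp add: algebra_simps)
qed

text \<open>
  The mean of the splitting inequalities for \<open>\<theta> = 1\<close> and \<open>\<theta> = -1\<close>.
\<close>

lemma observer_energy_admissible:
  assumes "1 < \<Gamma>" "\<Gamma> \<le> 2" and X: "X \<in> admissible \<Gamma>" and w: "norm w < 1"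
  shows "observer_energy w C X + mag_pressure w C > 0"
  using flux1_splitting[OF assms, of 1 C] flux1_splitting[OF assms, of "-1" C]
  unfolding observer_energy_add observer_energy_scaleR by (simp add: algebra_simps)

lemma lax_friedrichs_step_convex:
  "X - l *\<^sub>R (lf_flux1 \<Gamma> X R - lf_flux1 \<Gamma> L X) =
    (1 - l) *\<^sub>R X + (l / 2) *\<^sub>R ((L + 1 *\<^sub>R flux1 \<Gamma> L) + (R + (-1) *\<^sub>R flux1 \<Gamma> R))"
proof -
  have "(flux1 \<Gamma> X + flux1 \<Gamma> R - (R - X)) - (flux1 \<Gamma> L + flux1 \<Gamma> X - (X - L)) =
      2 *\<^sub>R X - ((L + 1 *\<^sub>R flux1 \<Gamma> L) + (R + (-1) *\<^sub>R flux1 \<Gamma> R))"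
    by (simp add: scaleR_2)
  then have "lf_flux1 \<Gamma> X R - lf_flux1 \<Gamma> L X =
      (1 / 2) *\<^sub>R (2 *\<^sub>R X - ((L + 1 *\<^sub>R flux1 \<Gamma> L) + (R + (-1) *\<^sub>R flux1 \<Gamma> R)))"
    unfolding lf_flux1_def scaleR_diff_right[symmetric] by simp
  then show ?thesis
    by (simp add: scaleR_diff_right scaleR_diff_left)
qed

text \<open>
  The new state is a convex combination of \<open>X\<close> and of the mean of \<open>L + flux1 \<Gamma> L\<close> and
  \<open>R - flux1 \<Gamma> R\<close>. In the sum of the splitting inequalities for \<open>L\<close> and \<open>R\<close> the terms odd in \<open>\<theta>\<close>
  cancel, and this is where the equality of the two normal magnetic components is used:
  it is the discrete form of a divergence-free field.
\<close>

lemma lax_friedrichs_step_admissible: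
  assumes \<Gamma>: "1 < \<Gamma>" "\<Gamma> \<le> 2" and l: "0 < l" "l \<le> 1"
    and adm: "L \<in> admissible \<Gamma>" "X \<in> admissible \<Gamma>" "R \<in> admissible \<Gamma>"
    and B1: "B1_component L = B1_component R"
  shows "X - l *\<^sub>R (lf_flux1 \<Gamma> X R - lf_flux1 \<Gamma> L X) \<in> admissible \<Gamma>"
proof -
  define Z where "Z = X - l *\<^sub>R (lf_flux1 \<Gamma> X R - lf_flux1 \<Gamma> L X)"
  define Lp where "Lp = L + 1 *\<^sub>R flux1 \<Gamma> L"
  define Rm where "Rm = R + (-1) *\<^sub>R flux1 \<Gamma> R"
  have Z: "Z = (1 - l) *\<^sub>R X + (l / 2) *\<^sub>R (Lp + Rm)"
    unfolding Z_def Lp_def Rm_def by (rule lax_friedrichs_step_convex)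
  obtain D m B E where Z': "Z = (D, m, B, E)" by (cases Z)
  have "fst X > 0"
    using mass_flux1_splitting[OF adm(2), of 1] mass_flux1_splitting[OF adm(2), of "-1"] by simp
  then have "fst Z > 0"
    unfolding Z using mass_flux1_splitting[OF adm(1), of 1] mass_flux1_splitting[OF adm(3), of "-1"] l
    unfolding Lp_def[symmetric] Rm_def[symmetric]
    by (auto intro!: add_nonneg_pos)
  moreover have "observer_energy w C Z + mag_pressure w C > 0" if w: "norm w < 1" for w C
  proof -
    have "0 < (observer_energy w C Lp + (1 + w $ 1) * mag_pressure w C - B1_component L * (w \<bullet> C))
        + (observer_energy w C Rm + (1 - w $ 1) * mag_pressure w C + B1_component R * (w \<bullet> C))"
      using flux1_splitting[OF \<Gamma> adm(1) w, of 1 C] flux1_splitting[OF \<Gamma> adm(3) w, of "-1" C]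
      unfolding Lp_def Rm_def by simp
    also have "\<dots> = observer_energy w C Lp + observer_energy w C Rm + 2 * mag_pressure w C"
      unfolding B1 by (simp add: algebra_simps)
    finally have "0 < l / 2 * (observer_energy w C Lp + observer_energy w C Rm + 2 * mag_pressure w C)"
      using l by simp
    moreover have "0 \<le> (1 - l) * (observer_energy w C X + mag_pressure w C)"
      using observer_energy_admissible[OF \<Gamma> adm(2) w, of C] l by simp
    ultimately show ?thesis
      unfolding Z observer_energy_add observer_energy_scaleR by (simp add: algebra_simps)
  qed
  ultimately have "Z \<in> admissible \<Gamma>"
    unfolding Z' by (intro recover_primitive \<Gamma>(1)) auto
  then show ?thesis by (simp add: Z_def)
qed

theorem theorem3p1:
  fixes \<Gamma> \<Delta>x Bconst :: real
    and \<Delta>t :: "nat \<Rightarrow> real"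
    and U :: "nat \<Rightarrow> int \<Rightarrow> cons"
  assumes "1 < \<Gamma>" and "\<Gamma> \<le> 2"
    and "\<Delta>x > 0"
    and scheme: "\<And>n j. U (Suc n) j = U n j - (\<Delta>t n / \<Delta>x) *\<^sub>R
          (lf_flux1 \<Gamma> (U n j) (U n (j + 1)) - lf_flux1 \<Gamma> (U n (j - 1)) (U n j))"
    and CFL: "\<And>n. 0 < \<Delta>t n \<and> \<Delta>t n \<le> \<Delta>x / speed_of_light"
    and init_admissible: "\<And>j. U 0 j \<in> admissible \<Gamma>"
    and init_B1: "\<And>j. B1_component (U 0 j) = Bconst"
  shows "\<forall>n j. U n j \<in> admissible \<Gamma> \<and> B1_component (U n j) = Bconst"
proof -
  have "\<forall>j. U n j \<in> admissible \<Gamma> \<and> B1_component (U n j) = Bconst" for n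
  proof (induction n)
    case 0
    show ?case using init_admissible init_B1 by simp
  next
    case (Suc n)
    define l where "l = \<Delta>t n / \<Delta>x"
    have l: "0 < l" "l \<le> 1"
      using CFL[of n] \<open>\<Delta>x > 0\<close> by (auto simp: l_def speed_of_light_def field_simps)
    have "U (Suc n) j \<in> admissible \<Gamma>" for j
      unfolding scheme l_def[symmetric] using Suc.IH assms(1,2) l
      by (intro lax_friedrichs_step_admissible) auto
    moreover have "B1_component (U (Suc n) j) = Bconst" for j
      unfolding scheme lax_friedrichs_step_convex using Suc.IH
      by (simp add: B1_component_flux1 field_simps)
    ultimately show ?case by blast
  qed
  then show ?thesis by blast
qed

end
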